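(* Consider the cubic nonlinear Schrödinger equation $\mathrm{i}\,\partial_tu=-\Delta u+\lambda|u|^2u$, $u(0)=u_0$, $\lambda\in\mathbb{R}$, in a cube in $\mathbb{R}^d$ with periodic boundary conditions, and the iterated linearisation $$u^{[0]}(t)\equiv u_0,\qquad\mathrm{i}\,\partial_tu^{[k+1]}(t)=-\Delta u^{[k+1]}(t)+\lambda|u^{[k]}(t)|^2u^{[k+1]}(t),\quad u^{[k+1]}(0)=u_0,\qquad k=0,1,\dots,$$ with the same periodic boundary conditions. Then $\|u^{[k]}(t)\|_{L_2}=\|u_0\|_{L_2}$ for all $k\ge 0$ and all $t\ge0$ for which the iterates are defined; that is, the iterated linearisation preserves the $L_2$ energy.
   Context: $\|\cdot\|_{L_2}$ is the $L_2$ norm over the periodic cube (the $L_2$ energy). The linear equations for the iterates are understood to be solved exactly, and $u_0$ and the iterates are assumed sufficiently regular. *)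

theory Defs
  imports "HOL-Analysis.Analysis"
begin

text \<open>A function on a cube of side \<open>L\<close> with periodic boundary conditions is represented by its
  \<open>L\<close>-periodic extension to the whole space.\<close>

definition periodic :: "real \<Rightarrow> (real ^ 'n \<Rightarrow> complex) \<Rightarrow> bool" where
  "periodic L f \<longleftrightarrow> (\<forall>x i. f (x + axis i L) = f x)"

definition L2_energy :: "real ^ 'n \<Rightarrow> real \<Rightarrow> (real ^ 'n \<Rightarrow> complex) \<Rightarrow> real" where
  "L2_energy a L f = sqrt (LINT x:cbox a (a + vec L)|lborel. (cmod (f x))\<^sup>2)"

definition partial_differentiable :: "'n \<Rightarrow> (real ^ 'n \<Rightarrow> complex) \<Rightarrow> real ^ 'n \<Rightarrow> bool" where
  "partial_differentiable i f x \<longleftrightarrow> (\<lambda>s. f (x + s *\<^sub>R axis i 1)) differentiable at 0"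

definition partial :: "'n \<Rightarrow> (real ^ 'n \<Rightarrow> complex) \<Rightarrow> real ^ 'n \<Rightarrow> complex" where
  "partial i f x = vector_derivative (\<lambda>s. f (x + s *\<^sub>R axis i 1)) (at 0)"

definition laplacian :: "(real ^ 'n \<Rightarrow> complex) \<Rightarrow> real ^ 'n \<Rightarrow> complex" where
  "laplacian f x = (\<Sum>i\<in>UNIV. partial i (partial i f) x)"

text \<open>The singleton \<open>{0}\<close> is excluded because \<open>vector_derivative\<close> is not determined there.\<close>

definition time_interval :: "real set \<Rightarrow> bool" where
  "time_interval J \<longleftrightarrow> is_interval J \<and> 0 \<in> J \<and> J \<subseteq> {0..} \<and> J \<noteq> {0}"

text \<open>The time derivative is one-sided at end points of \<open>J\<close>, in particular at time 0.\<close>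

definition time_deriv :: "real set \<Rightarrow> (real \<Rightarrow> real ^ 'n \<Rightarrow> complex) \<Rightarrow> real \<Rightarrow> real ^ 'n \<Rightarrow> complex" where
  "time_deriv J v t x = vector_derivative (\<lambda>s. v s x) (at t within J)"

text \<open>Regularity of classical solutions: once continuously differentiable in time and twice
  continuously differentiable in space, all derivatives being jointly continuous in \<open>(t, x)\<close>.\<close>

definition classically_regular :: "real set \<Rightarrow> (real \<Rightarrow> real ^ 'n \<Rightarrow> complex) \<Rightarrow> bool" where
  "classically_regular J v \<longleftrightarrow>
     continuous_on (J \<times> UNIV) (\<lambda>(t, x). v t x) \<and>
     (\<forall>t\<in>J. \<forall>x. (\<lambda>s. v s x) differentiable at t within J) \<and>
     continuous_on (J \<times> UNIV) (\<lambda>(t, x). time_deriv J v t x) \<and>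
     (\<forall>i. (\<forall>t\<in>J. \<forall>x. partial_differentiable i (v t) x) \<and>
          continuous_on (J \<times> UNIV) (\<lambda>(t, x). partial i (v t) x)) \<and>
     (\<forall>i j. (\<forall>t\<in>J. \<forall>x. partial_differentiable j (partial i (v t)) x) \<and>
            continuous_on (J \<times> UNIV) (\<lambda>(t, x). partial j (partial i (v t)) x))"

end

theory Submission
  imports Defs
begin

text \<open>Each iterate solves a linear Schroedinger equation \<open>\<i> v\<^sub>t = - \<Delta>v + V v\<close> whose potential
  \<open>V = \<lambda> \<bar>u\<^bsup>[k]\<^esup>\<bar>\<^sup>2\<close> is real, and for such an equation the generator is skew-adjoint, whatever
  \<open>V\<close> is. Hence no induction on \<open>k\<close> is required: the previous iterate enters only through \<open>V\<close>.

  Concretely, \<open>\<partial>\<^sub>t \<bar>v\<bar>\<^sup>2 = 2 Re (cnj v v\<^sub>t) = - 2 Im (cnj v \<Delta>v)\<close>, because the potential contributes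
  \<open>2 Re (- \<i> V \<bar>v\<bar>\<^sup>2) = 0\<close>. Moreover \<open>Im (cnj v \<Delta>v) = \<Sum>\<^sub>i \<partial>\<^sub>i Im (cnj v \<partial>\<^sub>i v)\<close>, since
  \<open>cnj (\<partial>\<^sub>i v) \<partial>\<^sub>i v\<close> is real; this is the divergence of a periodic field, and its integral over a period
  cube vanishes (\<open>integral_cube_periodic_derivative\<close>, \<open>integral_Im_cnj_laplacian\<close>). Differentiating
  under the integral sign then shows that the energy is constant on the time interval
  (\<open>L2_energy_schroedinger_real_potential\<close>), and the value at time 0 is that of the initial datum.

  The vanishing of \<open>\<integral> \<partial>\<^sub>i g\<close> is obtained without Fubini, by translation: \<open>\<integral> \<partial>\<^sub>i g\<close> is the derivative at
  \<open>s = 0\<close> of the integral of \<open>x \<mapsto> g (x + s e\<^sub>i)\<close>, which by periodicity does not depend on \<open>s\<close>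
  (\<open>integral_cube_periodic_shift\<close>).\<close>

section \<open>Periodic functions on the cube\<close>

text \<open>Cut the cube orthogonally to direction \<open>i\<close> at distance \<open>s\<close> from its lower face. Translating the cube
  by \<open>s\<close> keeps the upper part and replaces the lower slab by its copy one period further on, over
  which \<open>f\<close> has the same integral. In the proof the lower slab is \<open>cbox a c\<close> and the common part is
  \<open>cbox d b\<close>.\<close>

lemma integral_cube_periodic_shift:
  fixes f :: "real ^ 'n \<Rightarrow> real"
  assumes cont: "continuous_on UNIV f"
    and per: "\<And>x. f (x + axis i L) = f x"
    and s: "0 \<le> s" "s \<le> L"
  shows "integral (cbox a (a + vec L)) (\<lambda>x. f (x + axis i s)) = integral (cbox a (a + vec L)) f"
proof -
  define b where "b = a + vec L"
  define c :: "real ^ 'n" where "c = (\<chi> j. if j = i then a $ i + s else b $ j)"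
  define d :: "real ^ 'n" where "d = a + axis i s"
  have intble: "f integrable_on cbox p q" for p q
    by (rule integrable_continuous, rule continuous_on_subset[OF cont]) simp
  have hi: "(f has_integral integral (cbox p q) f) (cbox p q)" for p q
    using intble by (rule integrable_integral)
  \<comment> \<open>membership in a box, with the inequality in direction \<open>i\<close> singled out\<close>
  have box: "x \<in> cbox p q \<longleftrightarrow>
      (p $ i \<le> x $ i \<and> x $ i \<le> q $ i) \<and> (\<forall>j. j \<noteq> i \<longrightarrow> p $ j \<le> x $ j \<and> x $ j \<le> q $ j)"
    for x p q :: "real ^ 'n"
    unfolding mem_box_cart by metis
  have off: "axis i r $ j = 0" if "j \<noteq> i" for r :: real and j
    using that by (simp add: axis_def)
  have low: "cbox a b \<inter> {x. x \<bullet> axis i 1 \<le> a $ i + s} = cbox a c"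
    using s by (intro set_eqI) (simp add: box c_def b_def inner_axis, argo)
  have high: "cbox a b \<inter> {x. x \<bullet> axis i 1 \<ge> a $ i + s} = cbox d b"
    using s by (intro set_eqI) (simp add: box off d_def b_def inner_axis, argo)
  have low': "cbox d (b + axis i s) \<inter> {x. x \<bullet> axis i 1 \<ge> b $ i} = cbox (a + axis i L) (c + axis i L)"
    using s by (intro set_eqI) (simp add: box off d_def b_def c_def inner_axis, argo)
  have high': "cbox d (b + axis i s) \<inter> {x. x \<bullet> axis i 1 \<le> b $ i} = cbox d b"
    using s by (intro set_eqI) (simp add: box off d_def b_def inner_axis, argo)
  have slab: "integral (cbox (a + axis i L) (c + axis i L)) f = integral (cbox a c) f"
    using integral_shift_cbox[of "a + axis i L" "axis i L" "c + axis i L" f] by (simp add: per)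
  have "integral (cbox a b) f = integral (cbox a c) f + integral (cbox d b) f"
    by (rule integral_unique, rule has_integral_split[where k = "axis i 1" and c = "a $ i + s"])
       (simp_all only: low high hi axis_in_Basis_iff, simp)
  moreover have "integral (cbox d (b + axis i s)) f = integral (cbox d b) f + integral (cbox a c) f"
    by (rule integral_unique, rule has_integral_split[where k = "axis i 1" and c = "b $ i"])
       (simp_all only: low' high' hi slab[symmetric] axis_in_Basis_iff, simp)
  moreover have "integral (cbox a b) (\<lambda>x. f (x + axis i s)) = integral (cbox d (b + axis i s)) f"
    using integral_shift_cbox[of d "axis i s" "b + axis i s" f] by (simp add: d_def)
  ultimately show ?thesis
    by (simp add: b_def)
qed

text \<open>The integral of the translates of \<open>g\<close> along direction \<open>i\<close> is constant in the translation parameter,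
  and its derivative can be taken under the integral sign. One-sided translations \<open>0 \<le> s \<le> L\<close>
  are enough to determine that derivative.\<close>

lemma integral_cube_periodic_derivative:
  fixes g g' :: "real ^ 'n \<Rightarrow> real"
  assumes "L > 0"
    and cont: "continuous_on UNIV g" and cont': "continuous_on UNIV g'"
    and per: "\<And>x. g (x + axis i L) = g x"
    and deriv: "\<And>x. ((\<lambda>s. g (x + s *\<^sub>R axis i 1)) has_vector_derivative g' x) (at 0)"
  shows "integral (cbox a (a + vec L)) g' = 0"
proof -
  let ?Q = "cbox a (a + vec L)"
  let ?I = "\<lambda>s. integral ?Q (\<lambda>x. g (x + s *\<^sub>R axis i 1))"
  have deriv_s: "((\<lambda>s. g (x + s *\<^sub>R axis i 1)) has_vector_derivative g' (x + s *\<^sub>R axis i 1)) (at s within S)"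
    for x s S
  proof -
    have "((\<lambda>r. g (x + s *\<^sub>R axis i 1 + r *\<^sub>R axis i 1)) \<circ> (\<lambda>r. r - s) has_vector_derivative
        1 *\<^sub>R g' (x + s *\<^sub>R axis i 1)) (at s)"
    proof (rule vector_diff_chain_at)
      show "((\<lambda>r. r - s) has_vector_derivative 1) (at s)"
        by (auto intro!: derivative_eq_intros)
    qed (use deriv in simp)
    moreover have "x + s *\<^sub>R axis i 1 + (r - s) *\<^sub>R axis i 1 = x + r *\<^sub>R axis i 1" for r
      by (simp add: scaleR_left_diff_distrib)
    ultimately show ?thesis
      by (simp only: o_def scaleR_one has_vector_derivative_at_within)
  qed
  have "(?I has_vector_derivative integral ?Q (\<lambda>x. g' (x + 0 *\<^sub>R axis i 1))) (at 0 within {0..L})"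
  proof (rule leibniz_rule_vector_derivative[where fx = "\<lambda>s x. g' (x + s *\<^sub>R axis i 1)"])
    show "(\<lambda>x. g (x + s *\<^sub>R axis i 1)) integrable_on ?Q" for s
      by (intro integrable_continuous continuous_on_compose2[OF cont] continuous_intros) auto
    show "continuous_on ({0..L} \<times> ?Q) (\<lambda>(s, x). g' (x + s *\<^sub>R axis i 1))"
      unfolding case_prod_beta
      by (intro continuous_on_compose2[OF cont'] continuous_intros) auto
  qed (use \<open>L > 0\<close> deriv_s in auto)
  moreover have "(?I has_vector_derivative 0) (at 0 within {0..L})"
  proof (rule has_vector_derivative_transform)
    show "((\<lambda>s. integral ?Q g) has_vector_derivative 0) (at 0 within {0..L})"
      by simp
    have ax: "s *\<^sub>R axis i 1 = (axis i s :: real ^ 'n)" for s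
      by (simp add: vec_eq_iff axis_def)
    show "?I s = integral ?Q g" if "s \<in> {0..L}" for s
      using that unfolding ax by (intro integral_cube_periodic_shift cont per) auto
  qed (use \<open>L > 0\<close> in auto)
  ultimately have "integral ?Q (\<lambda>x. g' (x + 0 *\<^sub>R axis i 1)) = 0"
    using \<open>L > 0\<close> by (intro vector_derivative_unique_within_closed_interval[of 0 L 0 ?I])
      (simp_all only: cbox_interval, auto)
  then show ?thesis
    by simp
qed

section \<open>Symmetry of the Laplacian on periodic functions\<close>

lemma partial_periodic:
  assumes "periodic L f"
  shows "periodic L (partial i f)"
proof -
  have "f (x + axis j L + s *\<^sub>R axis i 1) = f (x + s *\<^sub>R axis i 1)" for x j s
    using assms unfolding periodic_def by (metis add.assoc add.commute)
  then show ?thesis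
    by (simp add: periodic_def partial_def)
qed

lemma has_vector_derivative_partial:
  assumes "partial_differentiable i f x"
  shows "((\<lambda>s. f (x + s *\<^sub>R axis i 1)) has_vector_derivative partial i f x) (at 0)"
  using assms unfolding partial_differentiable_def partial_def by (simp add: vector_derivative_works)

text \<open>The quadratic form \<open>\<integral> cnj f \<Delta>f\<close> is real, as befits a symmetric operator: its imaginary part
  integrates the divergence of the field \<open>Im (cnj f \<partial>\<^sub>i f)\<close>, which inherits the periodicity of \<open>f\<close>.\<close>

lemma integral_Im_cnj_laplacian:
  fixes f :: "real ^ 'n \<Rightarrow> complex"
  assumes "L > 0" and per: "periodic L f"
    and cont: "continuous_on UNIV f"
    and cont1: "\<And>i. continuous_on UNIV (partial i f)"
    and cont2: "\<And>i. continuous_on UNIV (partial i (partial i f))"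
    and diff1: "\<And>i x. partial_differentiable i f x"
    and diff2: "\<And>i x. partial_differentiable i (partial i f) x"
  shows "integral (cbox a (a + vec L)) (\<lambda>x. Im (cnj (f x) * laplacian f x)) = 0"
proof -
  let ?Q = "cbox a (a + vec L)"
  let ?h = "\<lambda>i x. Im (cnj (f x) * partial i (partial i f) x)"
  have cont_h: "continuous_on S (?h i)" for i S
    by (intro continuous_intros continuous_on_subset[OF cont] continuous_on_subset[OF cont2]) auto
  have zero: "integral ?Q (?h i) = 0" for i
  proof (rule integral_cube_periodic_derivative[where g = "\<lambda>x. Im (cnj (f x) * partial i f x)"])
    show "continuous_on UNIV (\<lambda>x. Im (cnj (f x) * partial i f x))"
      by (intro continuous_intros cont cont1)
    show "Im (cnj (f (x + axis i L)) * partial i f (x + axis i L)) = Im (cnj (f x) * partial i f x)" for x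
      using per partial_periodic[OF per, of i] by (simp add: periodic_def)
    fix x
    have "((\<lambda>s. Im (cnj (f (x + s *\<^sub>R axis i 1)) * partial i f (x + s *\<^sub>R axis i 1))) has_vector_derivative
        Im (cnj (f (x + 0 *\<^sub>R axis i 1)) * partial i (partial i f) x + cnj (partial i f x) * partial i f (x + 0 *\<^sub>R axis i 1))) (at 0)"
      by (intro bounded_linear.has_vector_derivative[OF bounded_linear_Im] has_vector_derivative_mult
          has_vector_derivative_cnj has_vector_derivative_partial diff1 diff2)
    \<comment> \<open>the product of the first derivatives is \<open>\<bar>\<partial>\<^sub>i f\<bar>\<^sup>2\<close>, which has no imaginary part\<close>
    then show "((\<lambda>s. Im (cnj (f (x + s *\<^sub>R axis i 1)) * partial i f (x + s *\<^sub>R axis i 1)))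
        has_vector_derivative ?h i x) (at 0)"
      by (simp add: algebra_simps)
  qed (use \<open>L > 0\<close> cont_h in auto)
  have "integral ?Q (\<lambda>x. Im (cnj (f x) * laplacian f x)) = integral ?Q (\<lambda>x. \<Sum>i\<in>UNIV. ?h i x)"
    by (simp only: laplacian_def sum_distrib_left Im_sum)
  also have "\<dots> = (\<Sum>i\<in>UNIV. integral ?Q (?h i))"
    by (intro integral_sum integrable_continuous cont_h) auto
  also have "\<dots> = 0"
    by (simp only: zero sum.neutral_const)
  finally show ?thesis .
qed

section \<open>Conservation of energy\<close>

lemma L2_energy_eq_integral:
  assumes "continuous_on UNIV f"
  shows "L2_energy a L f = sqrt (integral (cbox a (a + vec L)) (\<lambda>x. (cmod (f x))\<^sup>2))"
proof -
  have "set_integrable lborel (cbox a (a + vec L)) (\<lambda>x. (cmod (f x))\<^sup>2)"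
    unfolding set_integrable_def
    by (intro borel_integrable_compact continuous_intros continuous_on_subset[OF assms]) auto
  then show ?thesis
    by (simp add: L2_energy_def set_borel_integral_eq_integral)
qed

text \<open>A real potential rotates the phase of \<open>v\<close> pointwise and so does not change \<open>\<bar>v\<bar>\<close>; what is left of the
  rate of change of \<open>\<bar>v\<bar>\<^sup>2\<close> comes from the Laplacian and integrates to zero.\<close>

lemma L2_energy_schroedinger_real_potential:
  fixes v :: "real \<Rightarrow> real ^ 'n \<Rightarrow> complex" and V :: "real \<Rightarrow> real ^ 'n \<Rightarrow> real"
  assumes "L > 0" and J: "is_interval J"
    and reg: "classically_regular J v"
    and per: "\<And>t. t \<in> J \<Longrightarrow> periodic L (v t)"
    and eq: "\<And>t x. t \<in> J \<Longrightarrow>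
           \<i> * time_deriv J v t x = - laplacian (v t) x + of_real (V t x) * v t x"
    and st: "s \<in> J" "t \<in> J"
  shows "L2_energy a L (v s) = L2_energy a L (v t)"
proof -
  let ?Q = "cbox a (a + vec L)"
  let ?E = "\<lambda>t. integral ?Q (\<lambda>x. (cmod (v t x))\<^sup>2)"
  have slice: "continuous_on UNIV (F t)"
    if "continuous_on (J \<times> UNIV) (\<lambda>(t, x). F t x)" "t \<in> J"
    for t and F :: "real \<Rightarrow> real ^ 'n \<Rightarrow> complex"
  proof -
    have "continuous_on UNIV (\<lambda>x. (\<lambda>(t, x). F t x) (t, x))"
      by (rule continuous_on_compose2[OF that(1)]) (use that(2) in \<open>auto intro!: continuous_intros\<close>)
    then show ?thesis by simp
  qed
  have cont_v: "continuous_on UNIV (v t)" if "t \<in> J" for t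
    using reg that unfolding classically_regular_def by (intro slice) auto
  have E_deriv: "(?E has_vector_derivative 0) (at t within J)" if t: "t \<in> J" for t
  proof -
    let ?e' = "\<lambda>t x. 2 * Re (cnj (v t x) * time_deriv J v t x)"
    have "(?E has_vector_derivative integral ?Q (?e' t)) (at t within J)"
    proof (rule leibniz_rule_vector_derivative[where fx = ?e'])
      fix r x assume "r \<in> J"
      then have "((\<lambda>r. v r x) has_vector_derivative time_deriv J v r x) (at r within J)"
        using reg unfolding classically_regular_def time_deriv_def by (simp add: vector_derivative_works)
      then have "((\<lambda>r. Re (cnj (v r x) * v r x)) has_vector_derivative
          Re (cnj (v r x) * time_deriv J v r x + cnj (time_deriv J v r x) * v r x)) (at r within J)"
        by (intro bounded_linear.has_vector_derivative[OF bounded_linear_Re] has_vector_derivative_mult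
            has_vector_derivative_cnj)
      then show "((\<lambda>r. (cmod (v r x))\<^sup>2) has_vector_derivative ?e' r x) (at r within J)"
        by (simp add: cmod_power2 power2_eq_square[of "Re _"] power2_eq_square[of "Im _"] algebra_simps)
    next
      show "(\<lambda>x. (cmod (v r x))\<^sup>2) integrable_on ?Q" if "r \<in> J" for r
        by (intro integrable_continuous continuous_intros continuous_on_subset[OF cont_v[OF that]]) auto
    next
      have "continuous_on (J \<times> ?Q) (\<lambda>z. v (fst z) (snd z))"
           "continuous_on (J \<times> ?Q) (\<lambda>z. time_deriv J v (fst z) (snd z))"
        using reg unfolding classically_regular_def case_prod_beta
        by (auto elim!: continuous_on_subset)
      then show "continuous_on (J \<times> ?Q) (\<lambda>(r, x). ?e' r x)"
        unfolding case_prod_beta by (intro continuous_intros)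
    qed (use t J in \<open>auto simp: is_interval_convex\<close>)
    \<comment> \<open>the term \<open>- \<i> V v\<close> of \<open>v\<^sub>t\<close> drops out here because \<open>V\<close> is real\<close>
    moreover have "?e' t x = (-2) * Im (cnj (v t x) * laplacian (v t) x)" for x
    proof -
      have "time_deriv J v t x = \<i> * laplacian (v t) x - \<i> * of_real (V t x) * v t x"
      proof -
        have "time_deriv J v t x = - (\<i> * (\<i> * time_deriv J v t x))"
          by (simp add: mult.assoc[symmetric])
        then show ?thesis
          by (simp add: eq[OF t] algebra_simps)
      qed
      then show ?thesis
        by (simp only:) (simp add: algebra_simps)
    qed
    moreover have "integral ?Q (\<lambda>x. Im (cnj (v t x) * laplacian (v t) x)) = 0"
      using reg t unfolding classically_regular_def
      by (intro integral_Im_cnj_laplacian \<open>L > 0\<close> per slice[where F = "\<lambda>t. partial i (v t)" for i]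
          slice[where F = "\<lambda>t. partial i (partial i (v t))" for i] cont_v) auto
    ultimately show ?thesis
      by (simp only: integral_mult_right mult_zero_right)
  qed
  have "?E s = ?E t"
    by (rule has_derivative_zero_unique[where s = J and f = ?E])
       (use E_deriv J st in \<open>auto simp: has_vector_derivative_def is_interval_convex\<close>)
  then show ?thesis
    by (simp add: L2_energy_eq_integral cont_v st)
qed

theorem theorem4:
  fixes a :: "real ^ 'n" and L lam :: real
    and u0 :: "real ^ 'n \<Rightarrow> complex"
    and u :: "nat \<Rightarrow> real \<Rightarrow> real ^ 'n \<Rightarrow> complex"
    and J :: "nat \<Rightarrow> real set"
  assumes "L > 0"
    and "J 0 = {0..}"
    and "\<And>k. time_interval (J k)"
    and "\<And>k. J (Suc k) \<subseteq> J k"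
    and "\<And>k. classically_regular (J k) (u k)"
    and "\<And>k t. t \<in> J k \<Longrightarrow> periodic L (u k t)"
    and "\<And>t. t \<in> J 0 \<Longrightarrow> u 0 t = u0"
    and "\<And>k. u (Suc k) 0 = u0"
    and "\<And>k t x. t \<in> J (Suc k) \<Longrightarrow>
           \<i> * time_deriv (J (Suc k)) (u (Suc k)) t x =
             - laplacian (u (Suc k) t) x
             + of_real lam * of_real ((cmod (u k t x))\<^sup>2) * u (Suc k) t x"
  shows "\<forall>k. \<forall>t\<in>J k. L2_energy a L (u k t) = L2_energy a L u0"
proof (intro allI ballI)
  fix k t assume t: "t \<in> J k"
  show "L2_energy a L (u k t) = L2_energy a L u0"
  proof (cases k)
    case 0
    with t show ?thesis by (simp add: assms(7))
  next
    case (Suc m)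
    have "L2_energy a L (u (Suc m) t) = L2_energy a L (u (Suc m) 0)"
    proof (rule L2_energy_schroedinger_real_potential[where J = "J (Suc m)"
          and V = "\<lambda>t x. lam * (cmod (u m t x))\<^sup>2"])
      show "is_interval (J (Suc m))" "0 \<in> J (Suc m)"
        using assms(3)[of "Suc m"] by (auto simp: time_interval_def)
    qed (use assms t Suc in auto)
    then show ?thesis
      by (simp add: Suc assms(8))
  qed
qed

end
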